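(* Let $\mathbf{V}$ be the variety of algebras with a zeroary operation $0$, two unary operations $p$ and $q$, and a ternary operation $t$, subject to the following identities: (1) $p\,0=q\,0=p\,t(x,y,z)=q\,t(x,y,z)=0$; (2) $t(u,v,w)=0$ whenever any of $u,v,w$ is either $0$, or is itself of the form $t(u',v',w')$; (3) $t(a(x,y),\,b(x,y),\,c(x,y))=0$ for all derived operations $a,b,c$ in two variables. Then in the free $\mathbf{V}$-algebra $F_{\mathbf{V}}(x)$ on one generator $x$, the subalgebra generated by $px$ and $qx$ is free (in $\mathbf{V}$) on those two generators; but $F_{\mathbf{V}}(x)$ (and hence also the free $\mathbf{V}$-algebra on two generators) has no subalgebra that is free in $\mathbf{V}$ on three or more generators.
   Context: A variety is the class of all algebras of a given type satisfying a given set of identities. A derived operation is an operation determined by a term, i.e. by an expression built from variables by iterated application of the given (primitive) operations (a variable by itself is also a term). Identities (2) mean: $t(0,v,w)=t(u,0,w)=t(u,v,0)=0$ and $t(t(u',v',w'),v,w)=t(u,t(u',v',w'),w)=t(u,v,t(u',v',w'))=0$ identically. *)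

theory Defs
  imports "HOL-Library.FuncSet" "HOL-Library.Infinite_Typeclass"
begin

datatype (vars: 'v) trm =
    Var 'v
  | Zero
  | P "'v trm"
  | Q "'v trm"
  | T "'v trm" "'v trm" "'v trm"

record 'a alg =
  carrier :: "'a set"
  op0 :: 'a
  opp :: "'a \<Rightarrow> 'a"
  opq :: "'a \<Rightarrow> 'a"
  opt :: "'a \<Rightarrow> 'a \<Rightarrow> 'a \<Rightarrow> 'a"

primrec eval :: "'a alg \<Rightarrow> ('v \<Rightarrow> 'a) \<Rightarrow> 'v trm \<Rightarrow> 'a" where
  "eval A \<rho> (Var v) = \<rho> v"
| "eval A \<rho> Zero = op0 A"
| "eval A \<rho> (P r) = opp A (eval A \<rho> r)"
| "eval A \<rho> (Q r) = opq A (eval A \<rho> r)"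
| "eval A \<rho> (T r s t) = opt A (eval A \<rho> r) (eval A \<rho> s) (eval A \<rho> t)"

primrec subst :: "('v \<Rightarrow> 'w trm) \<Rightarrow> 'v trm \<Rightarrow> 'w trm" where
  "subst \<sigma> (Var v) = \<sigma> v"
| "subst \<sigma> Zero = Zero"
| "subst \<sigma> (P r) = P (subst \<sigma> r)"
| "subst \<sigma> (Q r) = Q (subst \<sigma> r)"
| "subst \<sigma> (T r s t) = T (subst \<sigma> r) (subst \<sigma> s) (subst \<sigma> t)"

definition closed_under :: "'a set \<Rightarrow> 'a alg \<Rightarrow> bool" where
  "closed_under S A \<longleftrightarrow> op0 A \<in> S \<and> (\<forall>a\<in>S. opp A a \<in> S) \<and> (\<forall>a\<in>S. opq A a \<in> S)
     \<and> (\<forall>a\<in>S. \<forall>b\<in>S. \<forall>c\<in>S. opt A a b c \<in> S)"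

definition hom :: "'a alg \<Rightarrow> 'b alg \<Rightarrow> ('a \<Rightarrow> 'b) set" where
  "hom A B = {h. h \<in> carrier A \<rightarrow> carrier B \<and> h (op0 A) = op0 B
     \<and> (\<forall>a\<in>carrier A. h (opp A a) = opp B (h a))
     \<and> (\<forall>a\<in>carrier A. h (opq A a) = opq B (h a))
     \<and> (\<forall>a\<in>carrier A. \<forall>b\<in>carrier A. \<forall>c\<in>carrier A.
          h (opt A a b c) = opt B (h a) (h b) (h c))}"

definition subalgebra :: "'a alg \<Rightarrow> 'a alg \<Rightarrow> bool" where
  "subalgebra S A \<longleftrightarrow> (\<exists>U. U \<subseteq> carrier A \<and> closed_under U A \<and> S = A\<lparr>carrier := U\<rparr>)"

definition subalgebra_generated :: "'a alg \<Rightarrow> 'a set \<Rightarrow> 'a alg" where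
  "subalgebra_generated A X =
     A\<lparr>carrier := \<Inter>{U. X \<subseteq> U \<and> U \<subseteq> carrier A \<and> closed_under U A}\<rparr>"

(* The defining identities, as pairs of terms in the variables Var 0, Var 1, ....
   In the last family the derived binary operations a, b, c are given by arbitrary
   terms in Var 0 and Var 1. *)
definition V_identities :: "(nat trm \<times> nat trm) set" where
  "V_identities =
    (let x = Var 0; y = Var 1; z = Var 2; u = Var 0; v = Var 1; w = Var 2;
         t' = T (Var 3) (Var 4) (Var 5)
     in {(P Zero, Zero), (Q Zero, Zero), (P (T x y z), Zero), (Q (T x y z), Zero)}
      \<union> {(T Zero v w, Zero), (T u Zero w, Zero), (T u v Zero, Zero)}
      \<union> {(T t' v w, Zero), (T u t' w, Zero), (T u v t', Zero)}
      \<union> {(T a b c, Zero) | a b c. vars a \<subseteq> {0, 1} \<and> vars b \<subseteq> {0, 1} \<and> vars c \<subseteq> {0, 1}})"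

definition V_algebra :: "'a alg \<Rightarrow> bool" where
  "V_algebra A \<longleftrightarrow> closed_under (carrier A) A \<and>
     (\<forall>(l, r)\<in>V_identities. \<forall>\<rho>. range \<rho> \<subseteq> carrier A \<longrightarrow> eval A \<rho> l = eval A \<rho> r)"

(* A is free in V on the set G of its elements. HOL cannot quantify over types inside
   a formula, so the type of the test algebras B is a parameter; freeness proper is
   freeness relative to every type. So freeness is claimed for arbitrary 'b, and refuted
   by refuting it for some sufficiently large 'b (relative to a one-element 'b, every
   algebra B is trivial and the condition degenerates). *)
definition free_on :: "'b itself \<Rightarrow> 'a alg \<Rightarrow> 'a set \<Rightarrow> bool" where
  "free_on (_ :: 'b itself) A G \<longleftrightarrow> V_algebra A \<and> G \<subseteq> carrier A \<and>
     (\<forall>B :: 'b alg. V_algebra B \<longrightarrow>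
       (\<forall>f \<in> G \<rightarrow> carrier B.
          \<exists>!h. h \<in> hom A B \<inter> extensional (carrier A) \<and> (\<forall>g\<in>G. h g = f g)))"

definition trms :: "'v set \<Rightarrow> 'v trm set" where
  "trms X = {r. vars r \<subseteq> X}"

(* The least congruence on the algebra of terms over X that identifies the two sides
   of every substitution instance of a defining identity. *)
inductive V_eq :: "'v set \<Rightarrow> 'v trm \<Rightarrow> 'v trm \<Rightarrow> bool" for X where
  inst: "(l, r) \<in> V_identities \<Longrightarrow> range \<sigma> \<subseteq> trms X \<Longrightarrow> V_eq X (subst \<sigma> l) (subst \<sigma> r)"
| refl: "r \<in> trms X \<Longrightarrow> V_eq X r r"
| sym: "V_eq X r s \<Longrightarrow> V_eq X s r"
| trans: "V_eq X r s \<Longrightarrow> V_eq X s t \<Longrightarrow> V_eq X r t"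
| congP: "V_eq X r r' \<Longrightarrow> V_eq X (P r) (P r')"
| congQ: "V_eq X r r' \<Longrightarrow> V_eq X (Q r) (Q r')"
| congT: "V_eq X r r' \<Longrightarrow> V_eq X s s' \<Longrightarrow> V_eq X t t' \<Longrightarrow> V_eq X (T r s t) (T r' s' t')"

definition V_class :: "'v set \<Rightarrow> 'v trm \<Rightarrow> 'v trm set" where
  "V_class X r = {s. V_eq X r s}"

definition F_V :: "'v set \<Rightarrow> 'v trm set alg" where
  "F_V X =
    \<lparr> carrier = trms X // {(r, s). V_eq X r s},
      op0 = V_class X Zero,
      opp = (\<lambda>a. \<Union>r\<in>a. V_class X (P r)),
      opq = (\<lambda>a. \<Union>r\<in>a. V_class X (Q r)),
      opt = (\<lambda>a b c. \<Union>r\<in>a. \<Union>s\<in>b. \<Union>t\<in>c. V_class X (T r s t)) \<rparr>"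

definition gen :: "'v set \<Rightarrow> 'v \<Rightarrow> 'v trm set" where
  "gen X x = V_class X (Var x)"

lemma vars_subst: "vars (subst \<sigma> r) = (\<Union>v\<in>vars r. vars (\<sigma> v))"
  by (induction r) auto

lemma eval_closed:
  "closed_under (carrier A) A \<Longrightarrow> (\<And>v. v \<in> vars r \<Longrightarrow> \<rho> v \<in> carrier A) \<Longrightarrow> eval A \<rho> r \<in> carrier A"
  by (induction r) (auto simp: closed_under_def)

lemma eval_subst: "eval A \<rho> (subst \<sigma> r) = eval A (\<lambda>v. eval A \<rho> (\<sigma> v)) r"
  by (induction r) auto

lemma V_eq_trms: "V_eq X r s \<Longrightarrow> r \<in> trms X \<and> s \<in> trms X"
  by (induction rule: V_eq.induct) (auto simp: trms_def vars_subst image_subset_iff subset_iff; blast)+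

lemma equiv_V_eq: "equiv (trms X) {(r, s). V_eq X r s}"
proof (rule equivI)
  show "{(r, s). V_eq X r s} \<subseteq> trms X \<times> trms X"
    by (auto dest: V_eq_trms)
  show "refl_on (trms X) {(r, s). V_eq X r s}"
    by (rule refl_onI) (simp add: V_eq.refl)
  show "sym {(r, s). V_eq X r s}"
    by (rule symI) (simp add: V_eq.sym)
  show "trans {(r, s). V_eq X r s}"
    by (rule transI) (use V_eq.trans in blast)
qed

lemma V_class_eq: "r \<in> trms X \<Longrightarrow> s \<in> trms X \<Longrightarrow> V_class X r = V_class X s \<longleftrightarrow> V_eq X r s"
  using eq_equiv_class_iff[OF equiv_V_eq, of r X s] by (simp add: V_class_def Image_def)

lemma V_class_eqI: "V_eq X r s \<Longrightarrow> V_class X r = V_class X s"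
  using V_class_eq V_eq_trms by metis

lemma carrier_F_V: "carrier (F_V X) = V_class X ` trms X"
  by (auto simp: F_V_def quotient_def V_class_def Image_def)

lemma V_class_self: "r \<in> trms X \<Longrightarrow> r \<in> V_class X r"
  by (simp add: V_class_def V_eq.refl)

lemma op0_F_V: "op0 (F_V X) = V_class X Zero"
  by (simp add: F_V_def)

lemma opp_F_V: "r \<in> trms X \<Longrightarrow> opp (F_V X) (V_class X r) = V_class X (P r)"
proof -
  assume r: "r \<in> trms X"
  have "V_class X (P s) = V_class X (P r)" if "s \<in> V_class X r" for s
    using that unfolding V_class_def[of X r]
    by (intro V_class_eqI V_eq.sym[OF V_eq.congP]) simp
  then have "(\<Union>s\<in>V_class X r. V_class X (P s)) = V_class X (P r)"
    using V_class_self[OF r] by blast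
  then show ?thesis
    by (simp add: F_V_def)
qed

lemma opq_F_V: "r \<in> trms X \<Longrightarrow> opq (F_V X) (V_class X r) = V_class X (Q r)"
proof -
  assume r: "r \<in> trms X"
  have "V_class X (Q s) = V_class X (Q r)" if "s \<in> V_class X r" for s
    using that unfolding V_class_def[of X r]
    by (intro V_class_eqI V_eq.sym[OF V_eq.congQ]) simp
  then have "(\<Union>s\<in>V_class X r. V_class X (Q s)) = V_class X (Q r)"
    using V_class_self[OF r] by blast
  then show ?thesis
    by (simp add: F_V_def)
qed

lemma opt_F_V:
  assumes r: "r \<in> trms X" and s: "s \<in> trms X" and t: "t \<in> trms X"
  shows "opt (F_V X) (V_class X r) (V_class X s) (V_class X t) = V_class X (T r s t)"
proof -
  have "V_class X (T r' s' t') = V_class X (T r s t)"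
    if "r' \<in> V_class X r" "s' \<in> V_class X s" "t' \<in> V_class X t" for r' s' t'
    using that
    unfolding V_class_def[of X r] V_class_def[of X s] V_class_def[of X t]
    by (intro V_class_eqI V_eq.sym[OF V_eq.congT]) simp_all
  then have "(\<Union>r'\<in>V_class X r. \<Union>s'\<in>V_class X s. \<Union>t'\<in>V_class X t. V_class X (T r' s' t'))
      = V_class X (T r s t)"
    using V_class_self[OF r] V_class_self[OF s] V_class_self[OF t] by blast
  then show ?thesis
    by (simp add: F_V_def)
qed

lemma closed_F_V: "closed_under (carrier (F_V X)) (F_V X)"
  unfolding closed_under_def
  by (auto simp: carrier_F_V op0_F_V opp_F_V opq_F_V opt_F_V)
     (auto simp: trms_def)

lemma eval_F_V:
  assumes "range \<sigma> \<subseteq> trms X"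
  shows "eval (F_V X) (\<lambda>v. V_class X (\<sigma> v)) r = V_class X (subst \<sigma> r)"
proof -
  have *: "subst \<sigma> s \<in> trms X" for s
    using assms by (auto simp: trms_def vars_subst)
  show ?thesis
    by (induction r) (auto simp: op0_F_V opp_F_V opq_F_V opt_F_V *)
qed

lemma V_algebra_F_V: "V_algebra (F_V X)"
proof -
  have "eval (F_V X) \<rho> l = eval (F_V X) \<rho> r"
    if lr: "(l, r) \<in> V_identities" and \<rho>: "range \<rho> \<subseteq> carrier (F_V X)" for l r \<rho>
  proof -
    have "\<forall>v. \<exists>s. s \<in> trms X \<and> \<rho> v = V_class X s"
      using \<rho> by (auto simp: carrier_F_V image_iff subset_iff)
    then obtain \<sigma> where \<sigma>: "\<And>v. \<sigma> v \<in> trms X" "\<And>v. \<rho> v = V_class X (\<sigma> v)"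
      by metis
    then have "\<rho> = (\<lambda>v. V_class X (\<sigma> v))" "range \<sigma> \<subseteq> trms X"
      by auto
    then show ?thesis
      using V_eq.inst[OF lr, of \<sigma> X] by (simp add: eval_F_V V_class_eqI)
  qed
  then show ?thesis
    unfolding V_algebra_def using closed_F_V by blast
qed

lemma V_eq_sound:
  assumes "V_eq X r s" "V_algebra B" "\<And>x. x \<in> X \<Longrightarrow> \<rho> x \<in> carrier B"
  shows "eval B \<rho> r = eval B \<rho> s"
  using assms(1)
proof (induction rule: V_eq.induct)
  case (inst l r \<sigma>)
  have "eval B \<rho> (\<sigma> v) \<in> carrier B" for v
  proof (rule eval_closed)
    show "closed_under (carrier B) B"
      using assms(2) by (simp add: V_algebra_def)
  next
    fix w assume "w \<in> vars (\<sigma> v)"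
    then show "\<rho> w \<in> carrier B"
      using inst(2) assms(3) by (auto simp: trms_def)
  qed
  then have "range (\<lambda>v. eval B \<rho> (\<sigma> v)) \<subseteq> carrier B"
    by auto
  then show ?case
    using assms(2) inst(1) unfolding V_algebra_def eval_subst by blast
qed auto

lemma free_on_F_V: "free_on TYPE('b) (F_V X) (gen X ` X)"
  unfolding free_on_def
proof (intro conjI allI impI ballI V_algebra_F_V)
  show "gen X ` X \<subseteq> carrier (F_V X)"
    by (auto simp: gen_def carrier_F_V trms_def)
next
  fix B :: "'b alg" and f
  assume B: "V_algebra B" and f: "f \<in> gen X ` X \<rightarrow> carrier B"
  define \<rho> where "\<rho> = (\<lambda>x. f (gen X x))"
  have \<rho>: "\<rho> x \<in> carrier B" if "x \<in> X" for x
    using f that by (auto simp: \<rho>_def)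
  have clB: "closed_under (carrier B) B"
    using B by (simp add: V_algebra_def)
  define h where "h = (\<lambda>a\<in>carrier (F_V X). eval B \<rho> (SOME r. r \<in> a))"
  have h: "h (V_class X r) = eval B \<rho> r" if r: "r \<in> trms X" for r
  proof -
    have "(SOME s. s \<in> V_class X r) \<in> V_class X r"
      using V_class_self[OF r] by (rule someI)
    then have "V_eq X r (SOME s. s \<in> V_class X r)"
      by (simp add: V_class_def)
    then show ?thesis
      using V_eq_sound[OF _ B, of X _ _ \<rho>] \<rho> r by (auto simp: h_def carrier_F_V)
  qed
  show "\<exists>!h. h \<in> hom (F_V X) B \<inter> extensional (carrier (F_V X)) \<and> (\<forall>g\<in>gen X ` X. h g = f g)"
  proof (rule ex1I[of _ h])
    have tr: "P r \<in> trms X" "Q r \<in> trms X" "T r s t \<in> trms X" "Zero \<in> trms X"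
      if "r \<in> trms X" "s \<in> trms X" "t \<in> trms X" for r s t
      using that by (auto simp: trms_def)
    have z: "Zero \<in> trms X"
      by (simp add: trms_def)
    have "h \<in> carrier (F_V X) \<rightarrow> carrier B"
      using \<rho> by (force simp: carrier_F_V h trms_def intro!: eval_closed[OF clB])
    then have "h \<in> hom (F_V X) B"
      by (auto simp: hom_def op0_F_V carrier_F_V opp_F_V opq_F_V opt_F_V h tr z)
    moreover have "h \<in> extensional (carrier (F_V X))"
      by (simp add: h_def)
    moreover have "h g = f g" if "g \<in> gen X ` X" for g
      using that by (auto simp: gen_def h trms_def \<rho>_def)
    ultimately show "h \<in> hom (F_V X) B \<inter> extensional (carrier (F_V X)) \<and> (\<forall>g\<in>gen X ` X. h g = f g)"
      by blast
  next
    fix k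
    assume k: "k \<in> hom (F_V X) B \<inter> extensional (carrier (F_V X)) \<and> (\<forall>g\<in>gen X ` X. k g = f g)"
    have mem: "V_class X r \<in> carrier (F_V X)" if "vars r \<subseteq> X" for r
      using that by (auto simp: carrier_F_V trms_def)
    have "k (V_class X r) = eval B \<rho> r" if "vars r \<subseteq> X" for r
      using that
    proof (induction r)
      case (Var x)
      then show ?case
        using k by (auto simp: gen_def \<rho>_def)
    next
      case Zero
      then show ?case
        using k by (auto simp: hom_def op0_F_V)
    next
      case (P r)
      then have "opp (F_V X) (V_class X r) = V_class X (trm.P r)"
        by (simp add: opp_F_V trms_def)
      with P mem[of r] k show ?case
        by (auto simp: hom_def)
    next
      case (Q r)
      then have "opq (F_V X) (V_class X r) = V_class X (trm.Q r)"
        by (simp add: opq_F_V trms_def)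
      with Q mem[of r] k show ?case
        by (auto simp: hom_def)
    next
      case (T r s t)
      then have "opt (F_V X) (V_class X r) (V_class X s) (V_class X t) = V_class X (trm.T r s t)"
        by (simp add: opt_F_V trms_def)
      moreover have "k (opt (F_V X) (V_class X r) (V_class X s) (V_class X t))
          = opt B (k (V_class X r)) (k (V_class X s)) (k (V_class X t))"
        using k T.prems mem by (simp add: hom_def)
      ultimately show ?case
        using T by simp
    qed
    then have "k a = h a" if "a \<in> carrier (F_V X)" for a
      using that by (auto simp: carrier_F_V h trms_def)
    then show "k = h"
      using k by (intro extensionalityI[of _ "carrier (F_V X)"]) (auto simp: h_def)
  qed
qed

end

(* A V-algebra generated by two elements satisfies t = 0 by the identities (3), and an algebra
   satisfying t = 0 lies in V as soon as p and q fix 0. Hence, if b and c are elements of a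
   V-algebra, one may adjoin to the subalgebra they generate a new element * with p * = b and
   q * = c. The homomorphism from F_V(x) sending x to * then sends px to b and qx to c, whence
   the subalgebra generated by px and qx is free. Subalgebras of F_V(x) and of F_V(y, z) satisfy
   t = 0, whereas t(a, b, c) is nonzero for distinct free generators a, b, c: this is seen in a
   five-element V-algebra. *)

theory Submission
  imports Defs
begin

section \<open>Generated subalgebras and homomorphisms on them\<close>

lemma eval_carrier_update [simp]: "eval (A\<lparr>carrier := U\<rparr>) = eval A"
proof (intro ext)
  show "eval (A\<lparr>carrier := U\<rparr>) \<rho> r = eval A \<rho> r" for \<rho> and r :: "'v trm"
    by (induction r) auto
qed

lemma closed_under_carrier_update [simp]:
  "closed_under S (A\<lparr>carrier := U\<rparr>) \<longleftrightarrow> closed_under S A"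
  by (simp add: closed_under_def)

lemma V_algebra_carrier_update:
  assumes "V_algebra A" "U \<subseteq> carrier A" "closed_under U A"
  shows "V_algebra (A\<lparr>carrier := U\<rparr>)"
  using assms unfolding V_algebra_def by (fastforce dest: order_trans)

lemma closed_under_Inter:
  "(\<And>U. U \<in> \<U> \<Longrightarrow> closed_under U A) \<Longrightarrow> closed_under (\<Inter>\<U>) A"
  by (simp add: closed_under_def)

text \<open>If \<open>X\<close> is not contained in the carrier of \<open>A\<close>, the
  intersection is over the empty family and equals \<open>UNIV\<close>, so no hypothesis on
  \<open>X\<close> appears.\<close>

lemma subset_subalgebra_generated: "X \<subseteq> carrier (subalgebra_generated A X)"
  by (auto simp: subalgebra_generated_def)

lemma subalgebra_generated_subset:
  "X \<subseteq> U \<Longrightarrow> U \<subseteq> carrier A \<Longrightarrow> closed_under U A \<Longrightarrow> carrier (subalgebra_generated A X) \<subseteq> U"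
  by (auto simp: subalgebra_generated_def)

lemma closed_subalgebra_generated:
  "closed_under (carrier (subalgebra_generated A X)) A"
  unfolding subalgebra_generated_def by (auto intro: closed_under_Inter)

text \<open>Hides the intersection, so that facts about replacing a carrier apply.\<close>

lemma subalgebra_generated_carrier_update:
  "subalgebra_generated A X = A\<lparr>carrier := carrier (subalgebra_generated A X)\<rparr>"
  by (simp add: subalgebra_generated_def)

lemma V_algebra_subalgebra_generated:
  assumes "V_algebra A" "X \<subseteq> carrier A"
  shows "V_algebra (subalgebra_generated A X)"
proof -
  have "carrier (subalgebra_generated A X) \<subseteq> carrier A"
    using assms by (intro subalgebra_generated_subset) (auto simp: V_algebra_def)
  then show ?thesis
    using V_algebra_carrier_update[OF assms(1) _ closed_subalgebra_generated]
    by (metis subalgebra_generated_carrier_update)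
qed

lemma hom_eq_on_subalgebra_generated:
  assumes "V_algebra A" "X \<subseteq> carrier A"
    and h: "h \<in> hom (subalgebra_generated A X) B" and k: "k \<in> hom (subalgebra_generated A X) B"
    and "\<And>a. a \<in> X \<Longrightarrow> h a = k a" and "a \<in> carrier (subalgebra_generated A X)"
  shows "h a = k a"
proof -
  let ?C = "carrier (subalgebra_generated A X)"
  have sub: "?C \<subseteq> carrier A"
    using assms by (intro subalgebra_generated_subset) (auto simp: V_algebra_def)
  \<comment> \<open>The equaliser of \<open>h\<close> and \<open>k\<close> is closed and contains
    \<open>X\<close>, so it is everything. The rewriting makes the operations those of
    \<open>A\<close>.\<close>
  have "closed_under {c \<in> ?C. h c = k c} A"
    using h k closed_subalgebra_generated[of A X]
    by (subst (asm) (1 2) subalgebra_generated_carrier_update) (simp add: closed_under_def hom_def)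
  then have "?C \<subseteq> {c \<in> ?C. h c = k c}"
    using assms(5) sub subset_subalgebra_generated[of X A]
    by (intro subalgebra_generated_subset) auto
  then show ?thesis
    using assms(6) by auto
qed

lemma free_on_obtain_hom:
  fixes B :: "'b alg"
  assumes "free_on TYPE('b) A G" "V_algebra B" "f \<in> G \<rightarrow> carrier B"
  obtains h where "h \<in> hom A B" "\<And>g. g \<in> G \<Longrightarrow> h g = f g"
proof -
  have "\<exists>!h. h \<in> hom A B \<inter> extensional (carrier A) \<and> (\<forall>g\<in>G. h g = f g)"
    using assms unfolding free_on_def by blast
  then obtain h where "h \<in> hom A B \<inter> extensional (carrier A) \<and> (\<forall>g\<in>G. h g = f g)"
    by (rule ex1E)
  then show thesis
    by (intro that[of h]) auto
qed

section \<open>Vanishing of t\<close>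

text \<open>Once t vanishes, (2) and (3) are immediate and (1) reduces to p 0 = q 0 = 0.\<close>

lemma V_algebra_zero_opt:
  assumes "closed_under (carrier A) A" "opp A (op0 A) = op0 A" "opq A (op0 A) = op0 A"
    and "\<And>a b c. opt A a b c = op0 A"
  shows "V_algebra A"
  using assms by (auto simp: V_algebra_def V_identities_def Let_def)

lemma opt_eval_binary_terms:
  assumes "V_algebra B" "range \<rho> \<subseteq> carrier B"
    and "vars r \<subseteq> {0, 1}" "vars s \<subseteq> {0, 1}" "vars t \<subseteq> {0, 1::nat}"
  shows "opt B (eval B \<rho> r) (eval B \<rho> s) (eval B \<rho> t) = op0 B"
proof -
  have "(T r s t, Zero) \<in> V_identities"
    using assms(3-5) by (auto simp: V_identities_def Let_def)
  then have "eval B \<rho> (T r s t) = eval B \<rho> Zero"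
    using assms(1,2) unfolding V_algebra_def by blast
  then show ?thesis
    by simp
qed

text \<open>Every element is the value of a term in two variables at the generators, so (3) applies.
  The case y = z covers one generator.\<close>

lemma opt_binary_F_V:
  assumes "a \<in> carrier (F_V {y, z})" "b \<in> carrier (F_V {y, z})" "c \<in> carrier (F_V {y, z})"
  shows "opt (F_V {y, z}) a b c = op0 (F_V {y, z})"
proof -
  define \<rho> where "\<rho> v = V_class {y, z} (Var (if v = (0::nat) then y else z))" for v
  have "\<exists>r. vars r \<subseteq> {0, 1} \<and> d = eval (F_V {y, z}) \<rho> r" if "d \<in> carrier (F_V {y, z})" for d
  proof -
    from that obtain s where s: "vars s \<subseteq> {y, z}" "d = V_class {y, z} s"
      by (auto simp: carrier_F_V trms_def)
    \<comment> \<open>The identities use variables from \<open>nat\<close>, so \<open>s\<close> is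
      renamed to \<open>Var 0\<close> and \<open>Var 1\<close>; substituting back recovers
      \<open>s\<close> even if y = z.\<close>
    define \<tau> where "\<tau> v = Var (if v = y then 0 else 1 :: nat)" for v
    have "subst (\<lambda>v. Var (if v = 0 then y else z)) (subst \<tau> s) = s"
      using s(1) by (induction s) (auto simp: \<tau>_def)
    moreover have "eval (F_V {y, z}) \<rho> (subst \<tau> s)
        = V_class {y, z} (subst (\<lambda>v. Var (if v = 0 then y else z)) (subst \<tau> s))"
      unfolding \<rho>_def by (rule eval_F_V) (auto simp: trms_def)
    moreover have "vars (subst \<tau> s) \<subseteq> {0, 1}"
      by (auto simp: vars_subst \<tau>_def)
    ultimately show ?thesis
      using s(2) by metis
  qed
  moreover have "range \<rho> \<subseteq> carrier (F_V {y, z})"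
    by (auto simp: \<rho>_def carrier_F_V trms_def)
  ultimately show ?thesis
    using opt_eval_binary_terms[OF V_algebra_F_V] assms by metis
qed

section \<open>Freeness on px and qx\<close>

lemma opp_gen_neq_opq_gen: "opp (F_V {x}) (gen {x} x) \<noteq> opq (F_V {x}) (gen {x} x)"
proof
  have x: "Var x \<in> trms {x}" "P (Var x) \<in> trms {x}" "Q (Var x) \<in> trms {x}"
    by (auto simp: trms_def)
  assume "opp (F_V {x}) (gen {x} x) = opq (F_V {x}) (gen {x} x)"
  then have eq: "V_eq {x} (P (Var x)) (Q (Var x))"
    using x by (simp add: gen_def opp_F_V opq_F_V V_class_eq)
  \<comment> \<open>Under x = 1, the terms px and qx take the values 2 and 0.\<close>
  define B :: "nat alg" where
    "B = \<lparr>carrier = UNIV, op0 = 0, opp = (\<lambda>a. if a = 1 then 2 else 0), opq = (\<lambda>_. 0),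
      opt = (\<lambda>_ _ _. 0)\<rparr>"
  have "V_algebra B"
    by (rule V_algebra_zero_opt) (auto simp: B_def closed_under_def)
  then have "eval B (\<lambda>_. 1) (P (Var x)) = eval B (\<lambda>_. 1) (Q (Var x))"
    using V_eq_sound[OF eq, of B "\<lambda>_. 1"] by (simp add: B_def)
  then show False
    by (simp add: B_def)
qed

text \<open>The existence half of the universal property of {px, qx}, with prescribed images
  \<open>b\<close> and \<open>c\<close>.\<close>

lemma ex_hom_adjoin_root:
  fixes B :: "'b alg"
  assumes B: "V_algebra B" and bc: "b \<in> carrier B" "c \<in> carrier B"
  obtains h where "h \<in> hom (subalgebra_generated (F_V {x})
      {opp (F_V {x}) (gen {x} x), opq (F_V {x}) (gen {x} x)}) B"
    "h (opp (F_V {x}) (gen {x} x)) = b" "h (opq (F_V {x}) (gen {x} x)) = c"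
proof -
  let ?F = "F_V {x}"
  let ?g = "gen {x} x"
  let ?G = "{opp ?F ?g, opq ?F ?g}"
  have clB: "closed_under (carrier B) B"
    using B by (simp add: V_algebra_def)
  define \<rho> where "\<rho> v = (if v = (0::nat) then b else c)" for v
  \<comment> \<open>The subalgebra generated by \<open>b\<close> and \<open>c\<close>, described by
    binary terms so that (3) gives t = 0 on it.\<close>
  define D where "D = eval B \<rho> ` {r. vars r \<subseteq> {0, 1}}"
  have \<rho>: "range \<rho> \<subseteq> carrier B"
    using bc by (auto simp: \<rho>_def)
  have D_sub: "D \<subseteq> carrier B"
    using \<rho> by (auto simp: D_def intro!: eval_closed[OF clB])
  have D_opt: "opt B a1 a2 a3 = op0 B" if "a1 \<in> D" "a2 \<in> D" "a3 \<in> D" for a1 a2 a3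
    using that by (auto simp: D_def intro!: opt_eval_binary_terms[OF B \<rho>])
  have D_gens: "b \<in> D" "c \<in> D"
    by (auto simp: D_def \<rho>_def image_iff intro: exI[of _ "Var 0"] exI[of _ "Var 1"])
  have D_0: "op0 B \<in> D"
    by (auto simp: D_def image_iff intro: exI[of _ Zero])
  have D_p: "opp B a \<in> D" and D_q: "opq B a \<in> D" if "a \<in> D" for a
  proof -
    from that obtain r where "vars r \<subseteq> {0, 1}" "a = eval B \<rho> r"
      by (auto simp: D_def)
    then have "opp B a = eval B \<rho> (P r)" "opq B a = eval B \<rho> (Q r)"
      "vars (P r) \<subseteq> {0, 1}" "vars (Q r) \<subseteq> {0, 1}"
      by auto
    then show "opp B a \<in> D" "opq B a \<in> D"
      unfolding D_def by blast+
  qed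
  \<comment> \<open>\<open>None\<close> is the adjoined element. Setting t to 0 everywhere agrees
    with \<open>opt B\<close> on \<open>D\<close> by \<open>D_opt\<close>; no operation returns
    \<open>None\<close>.\<close>
  define E :: "'b option alg" where
    "E = \<lparr>carrier = insert None (Some ` D), op0 = Some (op0 B),
      opp = (\<lambda>e. Some (case e of None \<Rightarrow> b | Some a \<Rightarrow> opp B a)),
      opq = (\<lambda>e. Some (case e of None \<Rightarrow> c | Some a \<Rightarrow> opq B a)),
      opt = (\<lambda>_ _ _. Some (op0 B))\<rparr>"
  have pq0: "opp B (op0 B) = op0 B" "opq B (op0 B) = op0 B"
  proof -
    have "(P Zero, Zero) \<in> V_identities" "(Q Zero, Zero) \<in> V_identities"
      by (auto simp: V_identities_def Let_def)
    then have "eval B \<rho> (P Zero) = eval B \<rho> Zero" "eval B \<rho> (Q Zero) = eval B \<rho> Zero"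
      using B \<rho> unfolding V_algebra_def by blast+
    then show "opp B (op0 B) = op0 B" "opq B (op0 B) = op0 B"
      by auto
  qed
  have E: "V_algebra E"
    by (rule V_algebra_zero_opt)
      (auto simp: E_def closed_under_def D_0 D_p D_q D_gens pq0)
  have g: "?g \<in> carrier ?F"
    by (auto simp: gen_def carrier_F_V trms_def)
  have "(\<lambda>_. None) \<in> gen {x} ` {x} \<rightarrow> carrier E"
    by (simp add: E_def)
  then obtain k where k: "k \<in> hom ?F E" and "\<And>g. g \<in> gen {x} ` {x} \<Longrightarrow> k g = None"
    by (rule free_on_obtain_hom[OF free_on_F_V E]) simp
  then have kg: "k ?g = None"
    by simp
  have kpq: "k (opp ?F ?g) = Some b" "k (opq ?F ?g) = Some c"
    using k kg g by (auto simp: hom_def E_def)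
  \<comment> \<open>Since \<open>k\<close> sends x to \<open>None\<close>, only this preimage of the
    copy of \<open>D\<close> can be mapped on to \<open>B\<close>; it is closed and contains px and
    qx.\<close>
  define U where "U = {a \<in> carrier ?F. k a \<in> Some ` D}"
  have "closed_under U ?F"
    using k closed_F_V[of "{x}"]
    by (auto simp: closed_under_def U_def hom_def E_def D_0 D_p D_q)
  moreover have "?G \<subseteq> U"
    using kpq closed_F_V[of "{x}"] g by (auto simp: closed_under_def U_def D_gens)
  ultimately have S_sub: "carrier (subalgebra_generated ?F ?G) \<subseteq> U"
    by (intro subalgebra_generated_subset) (auto simp: U_def)
  \<comment> \<open>On \<open>C\<close> the values of \<open>k\<close> lie in the copy of
    \<open>D\<close>, where \<open>the\<close> undoes \<open>Some\<close>; t is preserved because it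
    vanishes on \<open>D\<close>.\<close>
  have "(\<lambda>a. the (k a)) \<in> hom (?F\<lparr>carrier := C\<rparr>) B" if "C \<subseteq> U" for C
  proof -
    have C: "a \<in> carrier ?F \<and> k a \<in> Some ` D" if "a \<in> C" for a
      using that \<open>C \<subseteq> U\<close> by (auto simp: U_def)
    have "the (k (opp ?F a)) = opp B (the (k a))" "the (k (opq ?F a)) = opq B (the (k a))"
      "the (k a) \<in> D" if "a \<in> C" for a
      using C[OF that] k by (auto simp: hom_def E_def)
    moreover have "the (k (opt ?F a1 a2 a3)) = op0 B"
      if "a1 \<in> C" "a2 \<in> C" "a3 \<in> C" for a1 a2 a3
      using C[OF that(1)] C[OF that(2)] C[OF that(3)] k by (auto simp: hom_def E_def)
    moreover have "the (k (op0 ?F)) = op0 B"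
      using k by (auto simp: hom_def E_def)
    ultimately show ?thesis
      using D_sub by (auto simp: hom_def D_opt)
  qed
  from this[OF S_sub] have "(\<lambda>a. the (k a)) \<in> hom (subalgebra_generated ?F ?G) B"
    by (metis subalgebra_generated_carrier_update)
  then show thesis
    using that[of "\<lambda>a. the (k a)"] kpq by simp
qed

text \<open>Existence comes from \<open>ex_hom_adjoin_root\<close>, uniqueness from the fact that px
  and qx generate.\<close>

lemma free_on_opp_opq_gen:
  defines "G \<equiv> \<lambda>x :: 'v. {opp (F_V {x}) (gen {x} x), opq (F_V {x}) (gen {x} x)}"
  shows "free_on TYPE('b) (subalgebra_generated (F_V {x}) (G x)) (G x)"
  unfolding free_on_def
proof (intro conjI allI impI ballI)
  let ?S = "subalgebra_generated (F_V {x}) (G x)"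
  have "gen {x} x \<in> carrier (F_V {x})"
    by (auto simp: gen_def carrier_F_V trms_def)
  then have G: "G x \<subseteq> carrier (F_V {x})"
    using closed_F_V[of "{x}"] by (auto simp: G_def closed_under_def)
  then show S: "V_algebra ?S"
    by (rule V_algebra_subalgebra_generated[OF V_algebra_F_V])
  show GS: "G x \<subseteq> carrier ?S"
    by (rule subset_subalgebra_generated)
  fix B :: "'b alg" and f
  assume B: "V_algebra B" and f: "f \<in> G x \<rightarrow> carrier B"
  have "f (opp (F_V {x}) (gen {x} x)) \<in> carrier B" "f (opq (F_V {x}) (gen {x} x)) \<in> carrier B"
    using f by (auto simp: G_def)
  then obtain h where h: "h \<in> hom ?S B" "\<And>g. g \<in> G x \<Longrightarrow> h g = f g"
    using ex_hom_adjoin_root[OF B, of _ _ x] unfolding G_def by (metis insertE empty_iff)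
  \<comment> \<open>Restriction makes \<open>h\<close> extensional; closure of the carrier keeps it
    a homomorphism.\<close>
  have "restrict h (carrier ?S) \<in> hom ?S B"
    using h(1) S unfolding V_algebra_def closed_under_def hom_def by auto
  then show "\<exists>!h. h \<in> hom ?S B \<inter> extensional (carrier ?S) \<and> (\<forall>g\<in>G x. h g = f g)"
  proof (intro ex1I[of _ "restrict h (carrier ?S)"])
    fix k
    assume k: "k \<in> hom ?S B \<inter> extensional (carrier ?S) \<and> (\<forall>g\<in>G x. k g = f g)"
    then have "k a = h a" if "a \<in> carrier ?S" for a
      using hom_eq_on_subalgebra_generated[OF V_algebra_F_V G _ h(1) _ that] h(2) by auto
    then show "k = restrict h (carrier ?S)"
      using k by (intro extensionalityI[of _ "carrier ?S"]) auto
  qed (use h(2) GS in auto)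
qed

section \<open>No free subalgebra on three or more generators\<close>

text \<open>The five elements \<open>e 0\<close> to \<open>e 4\<close> carry the example: zero,
  three arguments and the value of t at them. The carrier is the whole type, and t is zero at all
  other triples.\<close>

lemma ex_V_algebra_opt_nonzero:
  obtains B :: "'c::infinite alg" and e1 e2 e3 where
    "V_algebra B" "e1 \<in> carrier B" "e2 \<in> carrier B" "e3 \<in> carrier B" "opt B e1 e2 e3 \<noteq> op0 B"
proof -
  obtain e :: "nat \<Rightarrow> 'c" where e: "inj e"
    using infinite_countable_subset infinite_UNIV by blast
  define B where
    "B = \<lparr>carrier = UNIV, op0 = e 0, opp = (\<lambda>_. e 0), opq = (\<lambda>_. e 0),
      opt = (\<lambda>a b c. if a = e 1 \<and> b = e 2 \<and> c = e 3 then e 4 else e 0)\<rparr>"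
  note [simp] = inj_eq[OF e]
  \<comment> \<open>Operations only yield \<open>e 0\<close> or \<open>e 4\<close>. Hence two
    variables cannot reach all of \<open>e 1\<close>, \<open>e 2\<close>, \<open>e 3\<close>, which
    gives (3).\<close>
  have bin: "eval B \<rho> r \<in> {\<rho> 0, \<rho> 1, e 0, e 4}" if "vars r \<subseteq> {0, 1 :: nat}" for \<rho> r
    using that by (induction r) (auto simp: B_def)
  have "opt B (eval B \<rho> a) (eval B \<rho> b) (eval B \<rho> c) = e 0"
    if "vars a \<subseteq> {0, 1}" "vars b \<subseteq> {0, 1}" "vars c \<subseteq> {0, 1 :: nat}" for \<rho> a b c
  proof -
    have "\<not> (eval B \<rho> a = e 1 \<and> eval B \<rho> b = e 2 \<and> eval B \<rho> c = e 3)"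
      using bin[OF that(1), of \<rho>] bin[OF that(2), of \<rho>] bin[OF that(3), of \<rho>] by auto
    then show ?thesis
      by (auto simp: B_def)
  qed
  moreover have "op0 B = e 0"
    by (simp add: B_def)
  \<comment> \<open>For (2), neither 0 nor a value of t is among \<open>e 1\<close>,
    \<open>e 2\<close>, \<open>e 3\<close>.\<close>
  ultimately have "eval B \<rho> l = eval B \<rho> r" if "(l, r) \<in> V_identities" for l r \<rho>
    using that unfolding V_identities_def Let_def by (auto simp: B_def)
  then have "V_algebra B"
    by (auto simp: V_algebra_def closed_under_def B_def)
  then show thesis
    by (rule that[of B "e 1" "e 2" "e 3"]) (auto simp: B_def)
qed

text \<open>A homomorphism sending three generators to \<open>e1\<close>, \<open>e2\<close>,
  \<open>e3\<close> would take t(g1, g2, g3) = 0 to a nonzero element.\<close>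

lemma not_free_on_zero_opt:
  fixes S :: "'a alg"
  assumes "\<And>a b c. a \<in> carrier S \<Longrightarrow> b \<in> carrier S \<Longrightarrow> c \<in> carrier S \<Longrightarrow> opt S a b c = op0 S"
    and "infinite G \<or> card G \<ge> 3"
  shows "\<not> free_on TYPE('c::infinite) S G"
proof
  assume free: "free_on TYPE('c) S G"
  \<comment> \<open>An infinite \<open>G\<close> has \<open>card G = 0\<close>; passing to three
    elements treats both cases together.\<close>
  obtain H where H: "H \<subseteq> G" "card H = 3"
    using assms(2) infinite_arbitrarily_large obtain_subset_with_card_n by metis
  then obtain g1 g2 g3 where "H = {g1, g2, g3}" and neq: "g1 \<noteq> g2" "g1 \<noteq> g3" "g2 \<noteq> g3"
    unfolding card_3_iff by blast
  with H have g: "g1 \<in> G" "g2 \<in> G" "g3 \<in> G"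
    by auto
  obtain B :: "'c alg" and e1 e2 e3 where B: "V_algebra B"
    and e: "e1 \<in> carrier B" "e2 \<in> carrier B" "e3 \<in> carrier B" "opt B e1 e2 e3 \<noteq> op0 B"
    by (rule ex_V_algebra_opt_nonzero)
  \<comment> \<open>All generators besides \<open>g1\<close> and \<open>g2\<close> share the value
    \<open>e3\<close>.\<close>
  define f where "f g = (if g = g1 then e1 else if g = g2 then e2 else e3)" for g
  have "f \<in> G \<rightarrow> carrier B"
    using e by (simp add: f_def)
  then obtain h where h: "h \<in> hom S B" "\<And>g. g \<in> G \<Longrightarrow> h g = f g"
    using free_on_obtain_hom[OF free B] by blast
  have GS: "g1 \<in> carrier S" "g2 \<in> carrier S" "g3 \<in> carrier S"
    using free g unfolding free_on_def by auto
  then have "opt B (h g1) (h g2) (h g3) = h (opt S g1 g2 g3)"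
    using h(1) by (simp add: hom_def)
  also have "\<dots> = op0 B"
    using assms(1) GS h(1) by (simp add: hom_def)
  finally show False
    using h(2) g neq e(4) by (simp add: f_def)
qed

lemma no_free_subalgebra_binary_F_V:
  assumes "subalgebra S (F_V {y, z})" "infinite G \<or> card G \<ge> 3"
  shows "\<not> free_on TYPE('c::infinite) S G"
proof (rule not_free_on_zero_opt[OF _ assms(2)])
  obtain U where "U \<subseteq> carrier (F_V {y, z})" "S = F_V {y, z}\<lparr>carrier := U\<rparr>"
    using assms(1) by (auto simp: subalgebra_def)
  then show "opt S a b c = op0 S" if "a \<in> carrier S" "b \<in> carrier S" "c \<in> carrier S" for a b c
    using that opt_binary_F_V[of a y z b c] by auto
qed

theorem proposition1:
  fixes x :: 'v and y z :: 'w
  assumes "y \<noteq> z"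
  shows
    "(let F = F_V {x}; px = opp F (gen {x} x); qx = opq F (gen {x} x)
      in px \<noteq> qx \<and> free_on TYPE('b) (subalgebra_generated F {px, qx}) {px, qx})
     \<and> \<not> (\<exists>S G. subalgebra S (F_V {x}) \<and> (infinite G \<or> card G \<ge> 3)
             \<and> free_on TYPE('c::infinite) S G)
     \<and> \<not> (\<exists>S G. subalgebra S (F_V {y, z}) \<and> (infinite G \<or> card G \<ge> 3)
             \<and> free_on TYPE('c::infinite) S G)"
proof (intro conjI)
  show "let F = F_V {x}; px = opp F (gen {x} x); qx = opq F (gen {x} x)
    in px \<noteq> qx \<and> free_on TYPE('b) (subalgebra_generated F {px, qx}) {px, qx}"
    unfolding Let_def using opp_gen_neq_opq_gen free_on_opp_opq_gen by (rule conjI)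
  \<comment> \<open>One generator is the case y = z = x, as \<open>{x, x}\<close> is
    \<open>{x}\<close>.\<close>
  show "\<not> (\<exists>S G. subalgebra S (F_V {x}) \<and> (infinite G \<or> card G \<ge> 3)
      \<and> free_on TYPE('c::infinite) S G)"
    using no_free_subalgebra_binary_F_V[of _ x x] unfolding insert_absorb2 by blast
  show "\<not> (\<exists>S G. subalgebra S (F_V {y, z}) \<and> (infinite G \<or> card G \<ge> 3)
      \<and> free_on TYPE('c::infinite) S G)"
    using no_free_subalgebra_binary_F_V[of _ y z] by blast
qed

end
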